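(* Let $P_{t|0}(g\mid g_0,O_s,O_e)$ be a square-integrable diffusion kernel on $SE(3)$ conditioned on point clouds $O_s,O_e\in\mathcal{O}$. For an initial conditional density $P_0(g_0\mid O_s,O_e)$ on $SE(3)$, let the diffused marginal be $$P_t(g\mid O_s,O_e)=\int_{SE(3)}dg_0\;P_{t|0}(g\mid g_0,O_s,O_e)\,P_0(g_0\mid O_s,O_e).$$ Then the diffused marginal $P_t$ is bi-equivariant for every bi-equivariant initial distribution $P_0$ if and only if the diffusion kernel $P_{t|0}$ is bi-equivariant.
   Context: $\mathcal{O}$ is the set of point clouds in $\mathbb{R}^3$, on which $SE(3)$ acts from the left by rigid motion of the points, written $\Delta g\cdot O$. $dg$ is the bi-invariant (Haar) measure on $SE(3)$; probability distributions on $SE(3)$ are identified with their density functions with respect to $dg$ (so densities are regarded up to null sets). A diffusion kernel $P_{t|0}(\cdot\mid g_0,O_s,O_e)$ is a conditional probability density on $SE(3)$ given $g_0\in SE(3)$ and $O_s,O_e\in\mathcal{O}$; square-integrable means that it is square-integrable in $g$. A conditional density $P(g\mid O_s,O_e)$ on $SE(3)$ is bi-equivariant if for all $\Delta g\in SE(3)$ and $O_s,O_e\in\mathcal{O}$, $$P(g\mid O_s,O_e)=P(\Delta g\,g\mid\Delta g\cdot O_s,O_e)=P(g\,\Delta g^{-1}\mid O_s,\Delta g\cdot O_e).$$ A bi-equivariant diffusion kernel is a square-integrable kernel $P_{t|0}$ satisfying, for all $\Delta g\in SE(3)$ (and all $O_s,O_e\in\mathcal{O}$), except on a set of measure zero,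 $$P_{t|0}(g\mid g_0,O_s,O_e)=P_{t|0}(\Delta g\,g\mid\Delta g\,g_0,\Delta g\cdot O_s,O_e)=P_{t|0}(g\,\Delta g^{-1}\mid g_0\,\Delta g^{-1},O_s,\Delta g\cdot O_e).$$
   Formalization: The "only if" direction is proved for rigid-motion-stable sets of finite point clouds in which no cloud is fixed by a non-identity element of SE(3); with the empty or a symmetric cloud it is false. The "if" direction holds for all finite point clouds. *)

theory Defs
  imports "HOL-Analysis.Analysis"
begin

(* The pair (R, v) stands for the rigid motion x |-> R x + v. *)
type_synonym rigid = "(real^3^3) \<times> (real^3)"

definition SE3 :: "rigid set" where
  "SE3 = {g. rotation_matrix (fst g)}"

definition se3_mult :: "rigid \<Rightarrow> rigid \<Rightarrow> rigid" (infixl "\<odot>" 70) where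
  "g \<odot> h = (fst g ** fst h, fst g *v snd h + snd g)"

definition se3_one :: rigid where
  "se3_one = (mat 1, 0)"

definition se3_inv :: "rigid \<Rightarrow> rigid" where
  "se3_inv g = (transpose (fst g), - (transpose (fst g) *v snd g))"

definition se3_act :: "rigid \<Rightarrow> real^3 \<Rightarrow> real^3" where
  "se3_act g x = fst g *v x + snd g"

lemma se3_one_closed: "se3_one \<in> SE3"
  by (simp add: SE3_def se3_one_def rotation_matrix_def orthogonal_matrix_id)

lemma se3_mult_closed: "g \<in> SE3 \<Longrightarrow> h \<in> SE3 \<Longrightarrow> g \<odot> h \<in> SE3"
  by (simp add: SE3_def se3_mult_def rotation_matrix_def orthogonal_matrix_mul det_mul)

lemma se3_inv_closed: "g \<in> SE3 \<Longrightarrow> se3_inv g \<in> SE3"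
  by (simp add: SE3_def se3_inv_def rotation_matrix_def orthogonal_matrix_transpose)

lemma se3_mult_assoc: "(g \<odot> h) \<odot> k = g \<odot> (h \<odot> k)"
  by (simp add: se3_mult_def matrix_mul_assoc matrix_vector_mul_assoc
      matrix_vector_right_distrib add.assoc)

lemma se3_one_left: "se3_one \<odot> g = g"
  by (simp add: se3_mult_def se3_one_def)

lemma se3_one_right: "g \<odot> se3_one = g"
  by (simp add: se3_mult_def se3_one_def)

lemma se3_inv_left: "g \<in> SE3 \<Longrightarrow> se3_inv g \<odot> g = se3_one"
  by (simp add: SE3_def se3_mult_def se3_inv_def se3_one_def rotation_matrix_def
      orthogonal_matrix_def)

lemma se3_inv_right:
  assumes "g \<in> SE3"
  shows "g \<odot> se3_inv g = se3_one"
proof -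
  have *: "fst g ** transpose (fst g) = mat 1"
    using assms by (simp add: SE3_def rotation_matrix_def orthogonal_matrix_def)
  have "fst g *v (transpose (fst g) *v snd g) = snd g"
    by (simp only: matrix_vector_mul_assoc * matrix_vector_mul_lid)
  with * show ?thesis
    by (simp add: se3_mult_def se3_inv_def se3_one_def linear_neg[OF matrix_vector_mul_linear])
qed

lemma se3_act_mult: "se3_act (g \<odot> h) x = se3_act g (se3_act h x)"
  by (simp add: se3_mult_def se3_act_def matrix_vector_mul_assoc
      matrix_vector_right_distrib add.assoc)

lemma se3_act_one: "se3_act se3_one x = x"
  by (simp add: se3_act_def se3_one_def)

(* A non-zero Radon measure on SE3 (with its subspace topology) invariant under both
   translations; these are exactly the Haar measures of the unimodular group SE3, which
   are unique up to a positive factor. *)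
definition bi_invariant_haar :: "rigid measure \<Rightarrow> bool" where
  "bi_invariant_haar \<mu> \<longleftrightarrow>
     sets \<mu> = sets (restrict_space borel SE3) \<and>
     emeasure \<mu> SE3 \<noteq> 0 \<and>
     (\<forall>C. compact C \<and> C \<subseteq> SE3 \<longrightarrow> emeasure \<mu> C < \<infinity>) \<and>
     (\<forall>a\<in>SE3. distr \<mu> \<mu> (\<lambda>g. a \<odot> g) = \<mu> \<and> distr \<mu> \<mu> (\<lambda>g. g \<odot> a) = \<mu>)"

type_synonym cloud = "(real^3) set"

definition cloud_act :: "rigid \<Rightarrow> cloud \<Rightarrow> cloud" where
  "cloud_act g X = se3_act g ` X"

definition point_cloud_family :: "cloud set \<Rightarrow> bool" where
  "point_cloud_family \<O> \<longleftrightarrow>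
     (\<forall>X\<in>\<O>. finite X) \<and> (\<forall>g\<in>SE3. \<forall>X\<in>\<O>. cloud_act g X \<in> \<O>)"

(* Trivial stabiliser.  A bi-equivariant density must be invariant under the stabilisers of
   its clouds, so at a cloud with rotational symmetry such densities no longer separate the
   kernels, and at the empty cloud none exists. *)
definition asymmetric_cloud :: "cloud \<Rightarrow> bool" where
  "asymmetric_cloud X \<longleftrightarrow> (\<forall>g\<in>SE3. cloud_act g X = X \<longrightarrow> g = se3_one)"

definition prob_density_on :: "'a measure \<Rightarrow> ('a \<Rightarrow> real) \<Rightarrow> bool" where
  "prob_density_on \<mu> p \<longleftrightarrow> (AE g in \<mu>. 0 \<le> p g) \<and> has_bochner_integral \<mu> p 1"

(* P g Os Oe is the density P(g | Os, Oe). *)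
type_synonym cond_dens = "rigid \<Rightarrow> cloud \<Rightarrow> cloud \<Rightarrow> real"

definition conditional_density :: "rigid measure \<Rightarrow> cloud set \<Rightarrow> cond_dens \<Rightarrow> bool" where
  "conditional_density \<mu> \<O> P \<longleftrightarrow>
     (\<forall>Os\<in>\<O>. \<forall>Oe\<in>\<O>. prob_density_on \<mu> (\<lambda>g. P g Os Oe))"

(* Densities are compared up to null sets. *)
definition bi_equivariant :: "rigid measure \<Rightarrow> cloud set \<Rightarrow> cond_dens \<Rightarrow> bool" where
  "bi_equivariant \<mu> \<O> P \<longleftrightarrow>
     (\<forall>\<Delta>\<in>SE3. \<forall>Os\<in>\<O>. \<forall>Oe\<in>\<O>. AE g in \<mu>.
        P g Os Oe = P (\<Delta> \<odot> g) (cloud_act \<Delta> Os) Oe \<and>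
        P g Os Oe = P (g \<odot> se3_inv \<Delta>) Os (cloud_act \<Delta> Oe))"

(* K g g0 Os Oe is the kernel P_{t|0}(g | g0, Os, Oe) at a fixed time t. *)
type_synonym kernel = "rigid \<Rightarrow> rigid \<Rightarrow> cloud \<Rightarrow> cloud \<Rightarrow> real"

(* Joint measurability in (g, g0) makes the marginal in g0 meaningful; no measurability
   in the point clouds is required. *)
definition diffusion_kernel :: "rigid measure \<Rightarrow> cloud set \<Rightarrow> kernel \<Rightarrow> bool" where
  "diffusion_kernel \<mu> \<O> K \<longleftrightarrow>
     (\<forall>Os\<in>\<O>. \<forall>Oe\<in>\<O>.
        (\<lambda>(g, g0). K g g0 Os Oe) \<in> borel_measurable (\<mu> \<Otimes>\<^sub>M \<mu>) \<and>
        (\<forall>g0\<in>SE3. prob_density_on \<mu> (\<lambda>g. K g g0 Os Oe)))"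

definition square_integrable_kernel :: "rigid measure \<Rightarrow> cloud set \<Rightarrow> kernel \<Rightarrow> bool" where
  "square_integrable_kernel \<mu> \<O> K \<longleftrightarrow>
     (\<forall>Os\<in>\<O>. \<forall>Oe\<in>\<O>. \<forall>g0\<in>SE3. integrable \<mu> (\<lambda>g. (K g g0 Os Oe)\<^sup>2))"

(* The exceptional null set, taken in the pair (g, g0), may depend on the motion and
   on the clouds. *)
definition bi_equivariant_kernel :: "rigid measure \<Rightarrow> cloud set \<Rightarrow> kernel \<Rightarrow> bool" where
  "bi_equivariant_kernel \<mu> \<O> K \<longleftrightarrow>
     (\<forall>\<Delta>\<in>SE3. \<forall>Os\<in>\<O>. \<forall>Oe\<in>\<O>. AE (g, g0) in \<mu> \<Otimes>\<^sub>M \<mu>.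
        K g g0 Os Oe = K (\<Delta> \<odot> g) (\<Delta> \<odot> g0) (cloud_act \<Delta> Os) Oe \<and>
        K g g0 Os Oe = K (g \<odot> se3_inv \<Delta>) (g0 \<odot> se3_inv \<Delta>) Os (cloud_act \<Delta> Oe))"

definition diffused_marginal :: "rigid measure \<Rightarrow> kernel \<Rightarrow> cond_dens \<Rightarrow> cond_dens" where
  "diffused_marginal \<mu> K P0 = (\<lambda>g Os Oe. \<integral>g0. K g g0 Os Oe * P0 g0 Os Oe \<partial>\<mu>)"

definition preserves_bi_equivariance :: "rigid measure \<Rightarrow> cloud set \<Rightarrow> kernel \<Rightarrow> bool" where
  "preserves_bi_equivariance \<mu> \<O> K \<longleftrightarrow>
     (\<forall>P0. conditional_density \<mu> \<O> P0 \<and> bi_equivariant \<mu> \<O> P0 \<longrightarrow>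
        bi_equivariant \<mu> \<O> (diffused_marginal \<mu> K P0))"

end

theory Submission
  imports Defs
begin

text \<open>If the kernel is bi-equivariant, the substitution \<open>g0 \<mapsto> \<Delta> g0\<close> (or \<open>g0 \<mapsto> g0 \<Delta>\<inverse>\<close>) in the marginal,
  which preserves the Haar measure, moves the motion from the kernel to the initial density.
  Conversely, when the clouds have trivial stabilisers, every density \<open>q\<close> is the member at
  \<open>(Os, Oe)\<close> of some bi-equivariant initial distribution.  Preservation of bi-equivariance then says
  that \<open>K(g, g0, Os, Oe)\<close> and \<open>K(\<Delta> g, \<Delta> g0, \<Delta> Os, Oe)\<close> have the same marginal against every \<open>q\<close>.
  Taking normalised indicators for \<open>q\<close>, the two kernels have the same integral over every
  rectangle, hence agree almost everywhere on the product.\<close>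

section \<open>Measure-preserving maps and probability kernels; later \<open>T\<close> is a left or
  a right translation of SE(3)\<close>

definition measure_invariant :: "'a measure \<Rightarrow> ('a \<Rightarrow> 'a) \<Rightarrow> bool" where
  "measure_invariant M T \<longleftrightarrow> T \<in> M \<rightarrow>\<^sub>M M \<and> distr M M T = M"

text \<open>Models a diffusion kernel at a fixed pair of clouds; the second argument is the
  conditioning variable.\<close>

definition prob_kernel_on :: "'a measure \<Rightarrow> ('a \<Rightarrow> 'a \<Rightarrow> real) \<Rightarrow> bool" where
  "prob_kernel_on M k \<longleftrightarrow> case_prod k \<in> borel_measurable (M \<Otimes>\<^sub>M M) \<and>
     (\<forall>y\<in>space M. prob_density_on M (\<lambda>x. k x y))"

lemma prob_density_on_measurable: "prob_density_on M p \<Longrightarrow> p \<in> borel_measurable M"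
  by (auto simp: prob_density_on_def has_bochner_integral_iff)

lemma measure_invariant_AE:
  assumes "measure_invariant M T" "AE x in M. P x"
  shows "AE x in M. P (T x)"
  using assms by (metis AE_distrD measure_invariant_def)

lemma measure_invariant_integral:
  assumes "measure_invariant M T" "(f :: 'a \<Rightarrow> real) \<in> borel_measurable M"
  shows "(\<integral>x. f (T x) \<partial>M) = (\<integral>x. f x \<partial>M)"
  using assms integral_distr[of T M M f] by (simp add: measure_invariant_def)

lemma measure_invariant_prob_density:
  assumes T: "measure_invariant M T" and p: "prob_density_on M p"
  shows "prob_density_on M (\<lambda>x. p (T x))"
proof -
  have [measurable]: "p \<in> borel_measurable M" "T \<in> M \<rightarrow>\<^sub>M M"
    using T p by (auto simp: measure_invariant_def prob_density_on_measurable)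
  have "integrable M (\<lambda>x. p (T x))"
    using integrable_distr_eq[of T M M p] T p
    by (simp add: measure_invariant_def prob_density_on_def has_bochner_integral_iff)
  then show ?thesis
    using measure_invariant_AE[OF T, of "\<lambda>x. 0 \<le> p x"] measure_invariant_integral[OF T, of p] p
    by (simp add: prob_density_on_def has_bochner_integral_iff)
qed

lemma measure_invariant_prob_kernel:
  assumes T: "measure_invariant M T" and k: "prob_kernel_on M k"
  shows "prob_kernel_on M (\<lambda>x y. k (T x) (T y))"
proof -
  have [measurable]: "T \<in> M \<rightarrow>\<^sub>M M" "case_prod k \<in> borel_measurable (M \<Otimes>\<^sub>M M)"
    using T k by (auto simp: measure_invariant_def prob_kernel_on_def)
  have "(\<lambda>(x, y). k (T x) (T y)) \<in> borel_measurable (M \<Otimes>\<^sub>M M)"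
    by measurable
  moreover have "prob_density_on M (\<lambda>x. k (T x) (T y))" if "y \<in> space M" for y
    using that k measurable_space[of T M M y]
    by (intro measure_invariant_prob_density[OF T, of "\<lambda>x. k x (T y)"]) (auto simp: prob_kernel_on_def)
  ultimately show ?thesis by (simp add: prob_kernel_on_def)
qed

text \<open>Substituting \<open>T y\<close> for \<open>y\<close> preserves the integral and moves
  \<open>T\<close> from the density into the kernel. Both directions of the equivalence rest on
  this.\<close>

lemma marginal_transport:
  assumes T: "measure_invariant M T" and k: "prob_kernel_on M k"
    and p: "prob_density_on M p" and q: "prob_density_on M q"
    and eq: "AE y in M. q y = p (T y)" and x: "x \<in> space M"
  shows "(\<integral>y. k x y * p y \<partial>M) = (\<integral>y. k x (T y) * q y \<partial>M)"
proof -
  have [measurable]: "T \<in> M \<rightarrow>\<^sub>M M" "case_prod k \<in> borel_measurable (M \<Otimes>\<^sub>M M)"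
      "p \<in> borel_measurable M" "q \<in> borel_measurable M"
    using T k p q by (auto simp: measure_invariant_def prob_kernel_on_def prob_density_on_measurable)
  have [measurable]: "(\<lambda>y. k x y) \<in> borel_measurable M"
    using x by measurable
  have "(\<integral>y. k x y * p y \<partial>M) = (\<integral>y. k x (T y) * p (T y) \<partial>M)"
    using measure_invariant_integral[OF T, of "\<lambda>y. k x y * p y"] by simp
  also have "\<dots> = (\<integral>y. k x (T y) * q y \<partial>M)"
    using eq x by (intro integral_cong_AE) (measurable, auto)
  finally show ?thesis .
qed

section \<open>Marginals of kernels over a sigma-finite measure\<close>

context sigma_finite_measure
begin

text \<open>The forward direction for one motion: \<open>k\<close> and \<open>p\<close> belong to
  the original clouds, \<open>k'\<close> and \<open>p'\<close> to the moved ones. A null set of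
  pairs has null sections at almost every \<open>x\<close>, so \<open>k\<close> can be replaced
  under the integral, and the substitution finishes.\<close>

lemma marginal_equivariant:
  assumes T: "measure_invariant M T" and k: "prob_kernel_on M k" and k': "prob_kernel_on M k'"
    and p: "prob_density_on M p" and p': "prob_density_on M p'"
    and k_eq: "AE z in M \<Otimes>\<^sub>M M. k (fst z) (snd z) = k' (T (fst z)) (T (snd z))"
    and p_eq: "AE y in M. p y = p' (T y)"
  shows "AE x in M. (\<integral>y. k x y * p y \<partial>M) = (\<integral>y. k' (T x) y * p' y \<partial>M)"
proof -
  interpret P: pair_sigma_finite M M ..
  have [measurable]: "T \<in> M \<rightarrow>\<^sub>M M" "case_prod k \<in> borel_measurable (M \<Otimes>\<^sub>M M)"
      "case_prod k' \<in> borel_measurable (M \<Otimes>\<^sub>M M)" "p \<in> borel_measurable M" "p' \<in> borel_measurable M"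
    using T k k' p p'
    by (auto simp: measure_invariant_def prob_kernel_on_def prob_density_on_measurable)
  show ?thesis
    using P.AE_pair[OF k_eq] AE_space
  proof eventually_elim
    case (elim x)
    have Tx: "T x \<in> space M" using elim(2) by (rule measurable_space[rotated]) measurable
    have [measurable]: "(\<lambda>y. k x y) \<in> borel_measurable M" "(\<lambda>y. k' (T x) y) \<in> borel_measurable M"
      using elim(2) Tx by measurable
    have "(\<integral>y. k x y * p y \<partial>M) = (\<integral>y. k' (T x) (T y) * p y \<partial>M)"
      using elim(1) by (intro integral_cong_AE) (measurable, auto)
    also have "\<dots> = (\<integral>y. k' (T x) y * p' y \<partial>M)"
      by (rule marginal_transport[OF T k' p' p p_eq Tx, symmetric])
    finally show ?case .
  qed
qed

text \<open>The definition gives nonnegativity for every \<open>y\<close> and almost every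
  \<open>x\<close>; Fubini exchanges the two variables.\<close>

lemma prob_kernel_nonneg:
  assumes "prob_kernel_on M k"
  shows "AE x in M. AE y in M. 0 \<le> k x y"
proof -
  interpret P: pair_sigma_finite M M ..
  have [measurable]: "case_prod k \<in> borel_measurable (M \<Otimes>\<^sub>M M)"
    using assms by (simp add: prob_kernel_on_def)
  have "AE y in M. AE x in M. 0 \<le> k x y"
  proof (rule AE_I2)
    show "AE x in M. 0 \<le> k x y" if "y \<in> space M" for y
      using assms that by (simp add: prob_kernel_on_def prob_density_on_def)
  qed
  then show ?thesis
    by (subst P.AE_commute) measurable
qed

lemma prob_kernel_nonneg_pair:
  assumes "prob_kernel_on M k"
  shows "AE z in M \<Otimes>\<^sub>M M. 0 \<le> case_prod k z"
proof -
  interpret P: pair_sigma_finite M M ..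
  have [measurable]: "case_prod k \<in> borel_measurable (M \<Otimes>\<^sub>M M)"
    using assms by (simp add: prob_kernel_on_def)
  show ?thesis
    using prob_kernel_nonneg[OF assms] by (intro P.AE_pair_measure) auto
qed

text \<open>By Tonelli the integral over \<open>x\<close> can be taken first, and it is 1 for each
  \<open>y\<close>. This supplies the finiteness used when kernels are compared as measures on the
  product.\<close>

lemma prob_kernel_strip_mass:
  assumes k: "prob_kernel_on M k" and A [measurable]: "A \<in> sets M"
  shows "(\<integral>\<^sup>+x. \<integral>\<^sup>+y. ennreal (k x y) * indicator A y \<partial>M \<partial>M) = emeasure M A"
proof -
  interpret P: pair_sigma_finite M M ..
  have [measurable]: "case_prod k \<in> borel_measurable (M \<Otimes>\<^sub>M M)"
    using k by (simp add: prob_kernel_on_def)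
  have "(\<integral>\<^sup>+x. \<integral>\<^sup>+y. ennreal (k x y) * indicator A y \<partial>M \<partial>M)
      = (\<integral>\<^sup>+y. \<integral>\<^sup>+x. ennreal (k x y) * indicator A y \<partial>M \<partial>M)"
    by (rule P.Fubini'[symmetric]) measurable
  also have "\<dots> = (\<integral>\<^sup>+y. indicator A y \<partial>M)"
  proof (intro nn_integral_cong)
    fix y assume y: "y \<in> space M"
    then have p: "prob_density_on M (\<lambda>x. k x y)"
      using k by (simp add: prob_kernel_on_def)
    note [measurable] = prob_density_on_measurable[OF p]
    have "(\<integral>\<^sup>+x. ennreal (k x y) \<partial>M) = 1"
      using p by (subst nn_integral_eq_integral) (auto simp: prob_density_on_def has_bochner_integral_iff)
    then show "(\<integral>\<^sup>+x. ennreal (k x y) * indicator A y \<partial>M) = indicator A y"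
      by (simp add: nn_integral_multc)
  qed
  finally show ?thesis by simp
qed

lemma prob_density_on_normalized_indicator:
  assumes "A \<in> sets M" "0 < emeasure M A" "emeasure M A < \<infinity>"
  shows "prob_density_on M (\<lambda>x. indicator A x / measure M A)"
  using assms by (auto simp: prob_density_on_def has_bochner_integral_iff measure_def enn2real_eq_0_iff less_top)

text \<open>The exceptional null set in \<open>marg\<close> depends on \<open>q\<close>. Integrating
  over \<open>x\<close> absorbs this dependence: the kernels, read as densities on the product, give
  measures that agree on rectangles and hence everywhere.\<close>

lemma prob_kernel_eq_of_marginals:
  assumes k1: "prob_kernel_on M k1" and k2: "prob_kernel_on M k2"
    and marg: "\<And>q. prob_density_on M q \<Longrightarrow>
      AE x in M. (\<integral>y. k1 x y * q y \<partial>M) = (\<integral>y. k2 x y * q y \<partial>M)"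
  shows "AE (x, y) in M \<Otimes>\<^sub>M M. k1 x y = k2 x y"
proof -
  interpret P: pair_sigma_finite M M ..
  have [measurable]: "case_prod k1 \<in> borel_measurable (M \<Otimes>\<^sub>M M)"
    "case_prod k2 \<in> borel_measurable (M \<Otimes>\<^sub>M M)"
    using k1 k2 by (auto simp: prob_kernel_on_def)
  define D where "D k = density (M \<Otimes>\<^sub>M M) (\<lambda>z. ennreal (case_prod k z))" for k :: "'a \<Rightarrow> 'a \<Rightarrow> real"
  have D_rect: "emeasure (D k) (B \<times> A)
      = (\<integral>\<^sup>+x. (\<integral>\<^sup>+y. ennreal (k x y) * indicator A y \<partial>M) * indicator B x \<partial>M)"
    if k: "prob_kernel_on M k" and [measurable]: "A \<in> sets M" "B \<in> sets M" for k A B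
  proof -
    have [measurable]: "case_prod k \<in> borel_measurable (M \<Otimes>\<^sub>M M)"
      using k by (simp add: prob_kernel_on_def)
    have "emeasure (D k) (B \<times> A)
        = (\<integral>\<^sup>+z. ennreal (case_prod k z) * indicator (B \<times> A) z \<partial>(M \<Otimes>\<^sub>M M))"
      unfolding D_def by (rule emeasure_density) measurable
    also have "\<dots> = (\<integral>\<^sup>+x. \<integral>\<^sup>+y. ennreal (k x y) * indicator (B \<times> A) (x, y) \<partial>M \<partial>M)"
      by (subst nn_integral_fst[symmetric]) auto
    also have "\<dots> = (\<integral>\<^sup>+x. \<integral>\<^sup>+y. (ennreal (k x y) * indicator A y) * indicator B x \<partial>M \<partial>M)"
      by (intro nn_integral_cong) (auto simp: indicator_def)
    also have "\<dots> = (\<integral>\<^sup>+x. (\<integral>\<^sup>+y. ennreal (k x y) * indicator A y \<partial>M) * indicator B x \<partial>M)"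
      by (intro nn_integral_cong nn_integral_multc) measurable
    finally show ?thesis .
  qed
  \<comment> \<open>A set of finite positive measure has a normalised indicator, which is an
    admissible \<open>q\<close>; for a null set both sides vanish.\<close>
  have strip_eq: "AE x in M. (\<integral>\<^sup>+y. ennreal (k1 x y) * indicator A y \<partial>M)
      = (\<integral>\<^sup>+y. ennreal (k2 x y) * indicator A y \<partial>M)"
    if A [measurable]: "A \<in> sets M" and fin: "emeasure M A < \<infinity>" for A
  proof (cases "emeasure M A = 0")
    case True
    then have "AE y in M. y \<notin> A" by (intro AE_not_in) (auto simp: null_sets_def)
    then have "(\<integral>\<^sup>+y. ennreal (k x y) * indicator A y \<partial>M) = (\<integral>\<^sup>+y. 0 \<partial>M)" for k and x :: 'a
      by (intro nn_integral_cong_AE) auto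
    then show ?thesis by simp
  next
    case False
    then have pos: "0 < emeasure M A" by (simp add: zero_less_iff_neq_zero)
    then have m: "0 < measure M A" using fin by (simp add: measure_def enn2real_positive_iff less_top)
    have scaled: "AE x in M. (\<integral>\<^sup>+y. ennreal (k x y) * indicator A y \<partial>M)
        = ennreal (measure M A * (\<integral>y. k x y * (indicator A y / measure M A) \<partial>M))"
      if k: "prob_kernel_on M k" for k
    proof -
      have [measurable]: "case_prod k \<in> borel_measurable (M \<Otimes>\<^sub>M M)"
        using k by (simp add: prob_kernel_on_def)
      \<comment> \<open>Finiteness is what lets the Bochner integral stand for the nonnegative one:
        \<open>enn2real\<close> sends infinity to 0.\<close>
      have "AE x in M. (\<integral>\<^sup>+y. ennreal (k x y) * indicator A y \<partial>M) \<noteq> \<infinity>"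
        using prob_kernel_strip_mass[OF k A] fin by (intro nn_integral_PInf_AE) auto
      then show ?thesis
        using prob_kernel_nonneg[OF k] AE_space
      proof eventually_elim
        case (elim x)
        have [measurable]: "(\<lambda>y. k x y) \<in> borel_measurable M" using elim(3) by measurable
        have "measure M A * (\<integral>y. k x y * (indicator A y / measure M A) \<partial>M)
            = (\<integral>y. k x y * indicator A y \<partial>M)"
          using m by simp
        also have "\<dots> = enn2real (\<integral>\<^sup>+y. ennreal (k x y * indicator A y) \<partial>M)"
          using elim(2) by (intro integral_eq_nn_integral) (measurable, auto)
        also have "(\<integral>\<^sup>+y. ennreal (k x y * indicator A y) \<partial>M)
            = (\<integral>\<^sup>+y. ennreal (k x y) * indicator A y \<partial>M)"
          by (intro nn_integral_cong) (auto simp: indicator_def)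
        finally show ?case using elim(1) by (simp add: less_top)
      qed
    qed
    show ?thesis
      using scaled[OF k1] scaled[OF k2] marg[OF prob_density_on_normalized_indicator[OF A pos fin]]
      by eventually_elim (simp only:)
  qed
  \<comment> \<open>Sets of infinite measure are reached by continuity from below along an
    exhaustion by sets of finite measure.\<close>
  obtain F :: "nat \<Rightarrow> 'a set" where F: "range F \<subseteq> sets M" "(\<Union>i. F i) = space M"
    "\<And>i. emeasure M (F i) \<noteq> \<infinity>" "incseq F"
    using sigma_finite_incseq by blast
  have F_sets [measurable]: "F i \<in> sets M" for i using F(1) by auto
  have rect_eq: "emeasure (D k1) (B \<times> A) = emeasure (D k2) (B \<times> A)"
    if [measurable]: "A \<in> sets M" "B \<in> sets M" for A B
  proof -
    have fin: "emeasure (D k1) (B \<times> (A \<inter> F n)) = emeasure (D k2) (B \<times> (A \<inter> F n))" for n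
    proof -
      have "emeasure M (A \<inter> F n) \<le> emeasure M (F n)" by (intro emeasure_mono) auto
      then have "emeasure M (A \<inter> F n) < \<infinity>"
        using F(3)[of n] by (auto simp: less_top intro: le_less_trans)
      from strip_eq[OF _ this] show ?thesis
        by (subst (1 2) D_rect) (auto intro!: k1 k2 nn_integral_cong_AE)
    qed
    have lim: "(SUP n. emeasure (D k) (B \<times> (A \<inter> F n))) = emeasure (D k) (B \<times> A)" for k
    proof -
      have "(\<Union>n. B \<times> (A \<inter> F n)) = B \<times> A"
        using F(2) sets.sets_into_space[of A M] by auto
      moreover have "incseq (\<lambda>n. B \<times> (A \<inter> F n))"
        using F(4) by (auto simp: incseq_def)
      moreover have "range (\<lambda>n. B \<times> (A \<inter> F n)) \<subseteq> sets (D k)"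
        by (auto simp: D_def)
      ultimately show ?thesis
        using SUP_emeasure_incseq[of "\<lambda>n. B \<times> (A \<inter> F n)" "D k"] by simp
    qed
    show ?thesis using lim[of k1] lim[of k2] fin by simp
  qed
  let ?E = "{a \<times> b |a b. a \<in> sets M \<and> b \<in> sets M}"
  have "D k1 = D k2"
  proof (rule measure_eqI_generator_eq[OF Int_stable_pair_measure_generator[of M M]])
    show "?E \<subseteq> Pow (space M \<times> space M)"
      using sets.space_closed[of M] by auto
    show "sets (D k1) = sigma_sets (space M \<times> space M) ?E"
      "sets (D k2) = sigma_sets (space M \<times> space M) ?E"
      by (auto simp: D_def sets_pair_measure)
    show "emeasure (D k1) X = emeasure (D k2) X" if "X \<in> ?E" for X
      using that rect_eq by auto
    \<comment> \<open>The mass of the whole product under \<open>D k1\<close> equals that of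
      \<open>space M\<close> under \<open>M\<close> and may be infinite, so uniqueness needs a cover
      of finite mass; the strip over \<open>F n\<close> has the mass of \<open>F n\<close>.\<close>
    show "range (\<lambda>n. space M \<times> F n) \<subseteq> ?E" using F(1) by auto
    show "(\<Union>n. space M \<times> F n) = space M \<times> space M" using F(2) by auto
    show "emeasure (D k1) (space M \<times> F n) \<noteq> \<infinity>" for n
    proof -
      have "emeasure (D k1) (space M \<times> F n)
          = (\<integral>\<^sup>+x. \<integral>\<^sup>+y. ennreal (k1 x y) * indicator (F n) y \<partial>M \<partial>M)"
        by (subst D_rect[OF k1]) (auto intro!: nn_integral_cong)
      then show ?thesis using prob_kernel_strip_mass[OF k1] F(3) by simp
    qed
  qed
  \<comment> \<open>Equal measures have almost everywhere equal densities, but only after truncation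
    by \<open>ennreal\<close>; nonnegativity of both kernels removes the truncation.\<close>
  then have "AE z in M \<Otimes>\<^sub>M M. ennreal (case_prod k1 z) = ennreal (case_prod k2 z)"
    unfolding D_def by (intro P.P.density_unique) measurable
  then show ?thesis
    using prob_kernel_nonneg_pair[OF k1] prob_kernel_nonneg_pair[OF k2]
    by eventually_elim auto
qed

end

section \<open>Topology of SE(3) and its Haar measure\<close>

lemma continuous_on_matrix_mult [continuous_intros]:
  fixes f :: "'a::topological_space \<Rightarrow> real^'m^'n" and g :: "'a \<Rightarrow> real^'k^'m"
  assumes "continuous_on S f" "continuous_on S g"
  shows "continuous_on S (\<lambda>x. f x ** g x)"
  unfolding matrix_matrix_mult_def by (intro continuous_intros assms)

lemma continuous_on_matrix_vector_mult [continuous_intros]: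
  fixes f :: "'a::topological_space \<Rightarrow> real^'m^'n" and g :: "'a \<Rightarrow> real^'m"
  assumes "continuous_on S f" "continuous_on S g"
  shows "continuous_on S (\<lambda>x. f x *v g x)"
  unfolding matrix_vector_mult_def by (intro continuous_intros assms)

lemma continuous_on_transpose [continuous_intros]:
  fixes f :: "'a::topological_space \<Rightarrow> real^'m^'n"
  assumes "continuous_on S f"
  shows "continuous_on S (\<lambda>x. transpose (f x))"
  unfolding transpose_def by (intro continuous_intros assms)

lemma continuous_on_det [continuous_intros]:
  fixes f :: "'a::topological_space \<Rightarrow> real^'n^'n"
  assumes "continuous_on S f"
  shows "continuous_on S (\<lambda>x. det (f x))"
  unfolding det_def by (intro continuous_intros assms)

lemma se3_mult_measurable_left: "(\<lambda>g. a \<odot> g) \<in> borel_measurable borel"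
  unfolding se3_mult_def by (intro borel_measurable_continuous_onI continuous_intros)

lemma se3_mult_measurable_right: "(\<lambda>g. g \<odot> a) \<in> borel_measurable borel"
  unfolding se3_mult_def by (intro borel_measurable_continuous_onI continuous_intros)

lemma closed_SE3: "closed SE3"
proof -
  have "SE3 = {g. transpose (fst g) ** fst g = mat 1} \<inter> {g. det (fst g) = 1}"
    by (auto simp: SE3_def rotation_matrix_def orthogonal_matrix)
  moreover have "closed ({g. transpose (fst g) ** fst g = (mat 1 :: real^3^3)} \<inter>
      {g :: rigid. det (fst g) = 1})"
    by (intro closed_Int closed_Collect_eq continuous_intros)
  ultimately show ?thesis by simp
qed

text \<open>The rows are unit vectors, and the Euclidean norm of the vector of row norms is at most
  their sum.\<close>

lemma norm_orthogonal_matrix_le: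
  fixes A :: "real^'n^'n"
  assumes "orthogonal_matrix A"
  shows "norm A \<le> CARD('n)"
proof -
  have "norm (A $ i) = 1" for i
    using assms by (simp add: orthogonal_matrix_orthonormal_rows row_def vec_nth_inverse)
  then show ?thesis
    using L2_set_le_sum[of UNIV "\<lambda>i. norm (A $ i)"] by (simp add: norm_vec_def)
qed

text \<open>Rotations are already bounded, so bounding the translation part suffices. These sets
  exhaust SE(3) and have finite Haar measure, which yields sigma-finiteness.\<close>

lemma compact_SE3_ball: "compact (SE3 \<inter> {g. norm (snd g) \<le> r})"
proof -
  have "closed (SE3 \<inter> {g. norm (snd g) \<le> r})"
    by (intro closed_Int closed_SE3 closed_Collect_le continuous_intros)
  moreover have "bounded (SE3 \<inter> {g. norm (snd g) \<le> r})"
  proof (rule boundedI)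
    fix g :: rigid assume g: "g \<in> SE3 \<inter> {g. norm (snd g) \<le> r}"
    then have "norm (fst g) \<le> 3"
      using norm_orthogonal_matrix_le[of "fst g"] by (auto simp: SE3_def rotation_matrix_def)
    then show "norm g \<le> 3 + r"
      using g norm_Pair_le[of "fst g" "snd g"] by simp
  qed
  ultimately show ?thesis by (simp add: compact_eq_bounded_closed)
qed

lemma space_haar: "bi_invariant_haar \<mu> \<Longrightarrow> space \<mu> = SE3"
  using sets_eq_imp_space_eq[of \<mu> "restrict_space borel SE3"]
  by (simp add: bi_invariant_haar_def space_restrict_space)

lemma sigma_finite_haar:
  assumes "bi_invariant_haar \<mu>"
  shows "sigma_finite_measure \<mu>"
proof
  let ?C = "\<lambda>n::nat. SE3 \<inter> {g. norm (snd g) \<le> real n}"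
  have sets: "sets \<mu> = sets (restrict_space borel SE3)"
    using assms by (simp add: bi_invariant_haar_def)
  have "?C n \<in> sets \<mu>" for n
    using compact_SE3_ball[of "real n"] closed_SE3
    by (simp add: sets sets_restrict_space_iff borel_closed borel_compact)
  moreover have "emeasure \<mu> (?C n) \<noteq> \<infinity>" for n
    using assms compact_SE3_ball[of "real n"] by (force simp: bi_invariant_haar_def)
  moreover have "(\<Union>n. ?C n) = SE3"
    using real_arch_simple by auto
  ultimately show "\<exists>A. countable A \<and> A \<subseteq> sets \<mu> \<and> \<Union> A = space \<mu> \<and> (\<forall>a\<in>A. emeasure \<mu> a \<noteq> \<infinity>)"
    by (intro exI[of _ "range ?C"]) (auto simp: space_haar[OF assms])
qed

text \<open>\<open>bi_invariant_haar\<close> only equates \<open>distr\<close> measures;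
  measurability of a translation comes from restricting a Borel map of the ambient space that
  preserves \<open>SE3\<close>.\<close>

lemma haar_translation_measurable:
  assumes "bi_invariant_haar \<mu>" "T \<in> borel_measurable borel" "T ` SE3 \<subseteq> SE3"
  shows "T \<in> \<mu> \<rightarrow>\<^sub>M \<mu>"
proof -
  have s: "sets \<mu> = sets (restrict_space borel SE3)"
    using assms by (simp add: bi_invariant_haar_def)
  show ?thesis
    unfolding measurable_cong_sets[OF s s]
    using assms by (intro measurable_restrict_space3) auto
qed

lemma haar_left_invariant:
  assumes "bi_invariant_haar \<mu>" "a \<in> SE3"
  shows "measure_invariant \<mu> (\<lambda>g. a \<odot> g)"
  using assms haar_translation_measurable[OF assms(1) se3_mult_measurable_left, of a]
  by (auto simp: measure_invariant_def bi_invariant_haar_def se3_mult_closed image_subset_iff)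

lemma haar_right_invariant:
  assumes "bi_invariant_haar \<mu>" "a \<in> SE3"
  shows "measure_invariant \<mu> (\<lambda>g. g \<odot> a)"
  using assms haar_translation_measurable[OF assms(1) se3_mult_measurable_right, of a]
  by (auto simp: measure_invariant_def bi_invariant_haar_def se3_mult_closed image_subset_iff)

section \<open>Group identities and equivariant frames of clouds\<close>

lemma se3_inv_cancel_left: "a \<in> SE3 \<Longrightarrow> se3_inv a \<odot> (a \<odot> g) = g"
  by (simp add: se3_mult_assoc[symmetric] se3_inv_left se3_one_left)

lemma se3_cancel_inv_left: "a \<in> SE3 \<Longrightarrow> a \<odot> (se3_inv a \<odot> g) = g"
  by (simp add: se3_mult_assoc[symmetric] se3_inv_right se3_one_left)

lemma se3_inv_unique:
  assumes "a \<in> SE3" "a \<odot> b = se3_one"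
  shows "b = se3_inv a"
  using se3_inv_cancel_left[OF assms(1), of b] assms(2) by (simp add: se3_one_right)

lemma se3_inv_mult:
  assumes "a \<in> SE3" "b \<in> SE3"
  shows "se3_inv (a \<odot> b) = se3_inv b \<odot> se3_inv a"
  using assms
  by (intro se3_inv_unique[symmetric])
    (simp_all add: se3_mult_closed se3_mult_assoc se3_cancel_inv_left se3_inv_right)

lemma se3_inv_inv: "a \<in> SE3 \<Longrightarrow> se3_inv (se3_inv a) = a"
  using se3_inv_unique[of "se3_inv a" a] by (simp add: se3_inv_closed se3_inv_left)

lemma cloud_act_mult: "cloud_act (g \<odot> h) X = cloud_act g (cloud_act h X)"
  by (simp add: cloud_act_def image_image se3_act_mult)

lemma cloud_act_one: "cloud_act se3_one X = X"
  by (simp add: cloud_act_def se3_act_one)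

text \<open>Choose a representative in every orbit and let \<open>s X\<close> carry the
  representative to \<open>X\<close>. Trivial stabilisers make this motion unique on
  \<open>\<O>\<close>, and uniqueness forces equivariance.\<close>

lemma equivariant_frame_exists:
  assumes family: "point_cloud_family \<O>" and free: "\<forall>X\<in>\<O>. asymmetric_cloud X"
  obtains s :: "cloud \<Rightarrow> rigid" where "\<And>X. s X \<in> SE3"
    "\<And>\<Delta> X. \<Delta> \<in> SE3 \<Longrightarrow> X \<in> \<O> \<Longrightarrow> s (cloud_act \<Delta> X) = \<Delta> \<odot> s X"
proof -
  define orbit where "orbit X = {Z. \<exists>h\<in>SE3. cloud_act h Z = X}" for X
  \<comment> \<open>The choice depends on \<open>X\<close> only through its orbit, so
    \<open>rep\<close> is constant on orbits.\<close>
  define rep where "rep X = (SOME Z. Z \<in> orbit X)" for X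
  define s where "s X = (SOME h. h \<in> SE3 \<and> cloud_act h (rep X) = X)" for X
  have "X \<in> orbit X" for X
    unfolding orbit_def using se3_one_closed cloud_act_one[of X] by blast
  then have "rep X \<in> orbit X" for X
    unfolding rep_def by (rule someI)
  then have "\<exists>h. h \<in> SE3 \<and> cloud_act h (rep X) = X" for X
    unfolding orbit_def by blast
  then have "s X \<in> SE3 \<and> cloud_act (s X) (rep X) = X" for X
    unfolding s_def by (rule someI_ex)
  then have s: "s X \<in> SE3" and s_rep: "cloud_act (s X) (rep X) = X" for X
    by auto
  have orbit_act: "orbit (cloud_act \<Delta> X) = orbit X" if \<Delta>: "\<Delta> \<in> SE3" for \<Delta> X
  proof (intro set_eqI iffI)
    fix Z assume "Z \<in> orbit (cloud_act \<Delta> X)"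
    then obtain h where h: "h \<in> SE3" "cloud_act h Z = cloud_act \<Delta> X"
      unfolding orbit_def by blast
    then have "cloud_act (se3_inv \<Delta> \<odot> h) Z = X"
      using \<Delta> by (metis cloud_act_mult cloud_act_one se3_inv_left)
    then show "Z \<in> orbit X"
      unfolding orbit_def using \<Delta> h se3_mult_closed se3_inv_closed by blast
  next
    fix Z assume "Z \<in> orbit X"
    then obtain h where "h \<in> SE3" "cloud_act h Z = X"
      unfolding orbit_def by blast
    then show "Z \<in> orbit (cloud_act \<Delta> X)"
      unfolding orbit_def using \<Delta> se3_mult_closed[of \<Delta> h] cloud_act_mult[of \<Delta> h Z] by blast
  qed
  have "s (cloud_act \<Delta> X) = \<Delta> \<odot> s X" if \<Delta>: "\<Delta> \<in> SE3" and X: "X \<in> \<O>" for \<Delta> X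
  proof -
    let ?h = "\<Delta> \<odot> s X" and ?X = "cloud_act \<Delta> X"
    have h: "?h \<in> SE3" "s ?X \<in> SE3" using \<Delta> s by (auto simp: se3_mult_closed)
    have rep: "rep ?X = rep X" by (simp add: rep_def orbit_act[OF \<Delta>])
    have "cloud_act ?h (rep X) = ?X"
      by (simp add: cloud_act_mult s_rep)
    then have "cloud_act (se3_inv ?h) ?X = rep X"
      using h by (metis cloud_act_mult cloud_act_one se3_inv_left)
    \<comment> \<open>Both \<open>?h\<close> and \<open>s ?X\<close> carry the common representative
      to \<open>?X\<close>; going back along one and forward along the other stabilises
      \<open>?X\<close>.\<close>
    then have "cloud_act (s ?X \<odot> se3_inv ?h) ?X = ?X"
      using s_rep[of ?X] rep by (simp add: cloud_act_mult)
    moreover have "?X \<in> \<O>" using family \<Delta> X by (simp add: point_cloud_family_def)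
    ultimately have "s ?X \<odot> se3_inv ?h = se3_one"
      using free h by (simp add: asymmetric_cloud_def se3_mult_closed se3_inv_closed)
    then have "se3_inv ?h = se3_inv (s ?X)" using h by (intro se3_inv_unique)
    then show ?thesis using h by (metis se3_inv_inv)
  qed
  with s show ?thesis by (intro that[of s]) auto
qed

text \<open>A density \<open>p\<close> spreads to a bi-equivariant family by reading it in the frames of the two
  clouds, as \<open>p (s X\<inverse> g s Y)\<close>; translating \<open>p\<close> makes the member at \<open>(Os, Oe)\<close> any given \<open>q\<close>.\<close>
lemma bi_equivariant_extension:
  assumes haar: "bi_invariant_haar \<mu>" and family: "point_cloud_family \<O>"
    and free: "\<forall>X\<in>\<O>. asymmetric_cloud X" and q: "prob_density_on \<mu> q"
  obtains P where "conditional_density \<mu> \<O> P" "bi_equivariant \<mu> \<O> P" "\<And>g. P g Os Oe = q g"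
proof -
  obtain s where s: "\<And>X. s X \<in> SE3"
    and s_act: "\<And>\<Delta> X. \<Delta> \<in> SE3 \<Longrightarrow> X \<in> \<O> \<Longrightarrow> s (cloud_act \<Delta> X) = \<Delta> \<odot> s X"
    using equivariant_frame_exists[OF family free] by blast
  define a where "a X = s Os \<odot> se3_inv (s X)" for X
  define b where "b Y = s Y \<odot> se3_inv (s Oe)" for Y
  have ab: "a X \<in> SE3" "b X \<in> SE3" for X
    using s by (auto simp: a_def b_def se3_mult_closed se3_inv_closed)
  define P where "P g X Y = q (a X \<odot> (g \<odot> b Y))" for g X Y
  have "conditional_density \<mu> \<O> P"
    unfolding conditional_density_def P_def
    using measure_invariant_prob_density[OF haar_right_invariant[OF haar ab(2)]
        measure_invariant_prob_density[OF haar_left_invariant[OF haar ab(1)] q]]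
    by auto
  \<comment> \<open>Moving \<open>X\<close> multiplies \<open>a X\<close> on the right by the
    inverse of the motion, and moving \<open>Y\<close> multiplies \<open>b Y\<close> on the left by
    the motion; the factors cancel at every \<open>g\<close>.\<close>
  moreover have "bi_equivariant \<mu> \<O> P"
    unfolding bi_equivariant_def P_def
    by (auto simp: a_def b_def s s_act se3_inv_mult se3_mult_assoc se3_inv_cancel_left)
  moreover have "P g Os Oe = q g" for g
    by (simp add: P_def a_def b_def s se3_inv_right se3_one_left se3_one_right)
  ultimately show ?thesis by (rule that)
qed

section \<open>The two directions of the equivalence\<close>

lemma diffusion_kernel_prob_kernel:
  assumes "bi_invariant_haar \<mu>" "diffusion_kernel \<mu> \<O> K" "Os \<in> \<O>" "Oe \<in> \<O>"
  shows "prob_kernel_on \<mu> (\<lambda>g g0. K g g0 Os Oe)"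
  using assms by (simp add: diffusion_kernel_def prob_kernel_on_def space_haar)

lemma preserves_bi_equivariance_if_kernel:
  assumes haar: "bi_invariant_haar \<mu>" and clouds: "point_cloud_family \<O>"
    and kernel: "diffusion_kernel \<mu> \<O> K" and equi: "bi_equivariant_kernel \<mu> \<O> K"
  shows "preserves_bi_equivariance \<mu> \<O> K"
  unfolding preserves_bi_equivariance_def bi_equivariant_def[of _ _ "diffused_marginal \<mu> K P0" for P0]
proof (intro allI impI ballI, elim conjE, unfold diffused_marginal_def, rule AE_conjI)
  fix P0 \<Delta> Os Oe
  assume P0: "conditional_density \<mu> \<O> P0" "bi_equivariant \<mu> \<O> P0"
    and \<Delta>: "\<Delta> \<in> SE3" and O: "Os \<in> \<O>" "Oe \<in> \<O>"
  interpret sigma_finite_measure \<mu> by (rule sigma_finite_haar[OF haar])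
  have moved: "cloud_act \<Delta> Os \<in> \<O>" "cloud_act \<Delta> Oe \<in> \<O>"
    using clouds \<Delta> O by (auto simp: point_cloud_family_def)
  have dens: "prob_density_on \<mu> (\<lambda>g. P0 g X Y)" if "X \<in> \<O>" "Y \<in> \<O>" for X Y
    using P0 that by (simp add: conditional_density_def)
  note kern = diffusion_kernel_prob_kernel[OF haar kernel]
  have K_eq: "AE z in \<mu> \<Otimes>\<^sub>M \<mu>.
      K (fst z) (snd z) Os Oe = K (\<Delta> \<odot> fst z) (\<Delta> \<odot> snd z) (cloud_act \<Delta> Os) Oe \<and>
      K (fst z) (snd z) Os Oe = K (fst z \<odot> se3_inv \<Delta>) (snd z \<odot> se3_inv \<Delta>) Os (cloud_act \<Delta> Oe)"
    using equi \<Delta> O by (simp add: bi_equivariant_kernel_def case_prod_beta)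
  have P_eq: "AE g in \<mu>. P0 g Os Oe = P0 (\<Delta> \<odot> g) (cloud_act \<Delta> Os) Oe \<and>
      P0 g Os Oe = P0 (g \<odot> se3_inv \<Delta>) Os (cloud_act \<Delta> Oe)"
    using P0 \<Delta> O by (simp add: bi_equivariant_def)
  show "AE g in \<mu>. (\<integral>g0. K g g0 Os Oe * P0 g0 Os Oe \<partial>\<mu>) =
      (\<integral>g0. K (\<Delta> \<odot> g) g0 (cloud_act \<Delta> Os) Oe * P0 g0 (cloud_act \<Delta> Os) Oe \<partial>\<mu>)"
    using K_eq P_eq
    by (intro marginal_equivariant[OF haar_left_invariant[OF haar \<Delta>]
          kern[OF O] kern[OF moved(1) O(2)] dens[OF O] dens[OF moved(1) O(2)]]) auto
  show "AE g in \<mu>. (\<integral>g0. K g g0 Os Oe * P0 g0 Os Oe \<partial>\<mu>) =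
      (\<integral>g0. K (g \<odot> se3_inv \<Delta>) g0 Os (cloud_act \<Delta> Oe) * P0 g0 Os (cloud_act \<Delta> Oe) \<partial>\<mu>)"
    using K_eq P_eq
    by (intro marginal_equivariant[OF haar_right_invariant[OF haar se3_inv_closed[OF \<Delta>]]
          kern[OF O] kern[OF O(1) moved(2)] dens[OF O] dens[OF O(1) moved(2)]]) auto
qed

lemma kernel_bi_equivariant_if_preserves:
  assumes haar: "bi_invariant_haar \<mu>" and clouds: "point_cloud_family \<O>"
    and kernel: "diffusion_kernel \<mu> \<O> K" and free: "\<forall>X\<in>\<O>. asymmetric_cloud X"
    and pres: "preserves_bi_equivariance \<mu> \<O> K"
  shows "bi_equivariant_kernel \<mu> \<O> K"
  unfolding bi_equivariant_kernel_def
proof (intro ballI)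
  fix \<Delta> Os Oe assume \<Delta>: "\<Delta> \<in> SE3" and O: "Os \<in> \<O>" "Oe \<in> \<O>"
  interpret sigma_finite_measure \<mu> by (rule sigma_finite_haar[OF haar])
  have moved: "cloud_act \<Delta> Os \<in> \<O>" "cloud_act \<Delta> Oe \<in> \<O>"
    using clouds \<Delta> O by (auto simp: point_cloud_family_def)
  note kern = diffusion_kernel_prob_kernel[OF haar kernel]
  \<comment> \<open>Treats both translations at once. \<open>T_eq\<close> ranges over all
    bi-equivariant families because it is used twice: for the initial density and for its diffused
    marginal.\<close>
  have transfer: "AE (g, g0) in \<mu> \<Otimes>\<^sub>M \<mu>. K g g0 Os Oe = K (T g) (T g0) X Y"
    if T: "measure_invariant \<mu> T" and XY: "X \<in> \<O>" "Y \<in> \<O>"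
      and T_eq: "\<And>P. bi_equivariant \<mu> \<O> P \<Longrightarrow> AE g in \<mu>. P g Os Oe = P (T g) X Y"
    for T X Y
  proof (rule prob_kernel_eq_of_marginals[OF kern[OF O] measure_invariant_prob_kernel[OF T kern[OF XY]]])
    fix q assume q: "prob_density_on \<mu> q"
    obtain P where P: "conditional_density \<mu> \<O> P" "bi_equivariant \<mu> \<O> P" "\<And>g. P g Os Oe = q g"
      using bi_equivariant_extension[OF haar clouds free q] by blast
    have dens: "prob_density_on \<mu> (\<lambda>g. P g X Y)"
      using P(1) XY by (simp add: conditional_density_def)
    have T_space: "T g \<in> space \<mu>" if "g \<in> space \<mu>" for g
      using that T by (auto simp: measure_invariant_def dest: measurable_space)
    have P_eq: "AE g in \<mu>. q g = P (T g) X Y"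
      using T_eq[OF P(2)] by (simp add: P(3))
    have "bi_equivariant \<mu> \<O> (diffused_marginal \<mu> K P)"
      using pres P by (simp add: preserves_bi_equivariance_def)
    from T_eq[OF this]
    have "AE g in \<mu>. (\<integral>g0. K g g0 Os Oe * q g0 \<partial>\<mu>) = (\<integral>g0. K (T g) g0 X Y * P g0 X Y \<partial>\<mu>)"
      by (simp add: diffused_marginal_def P(3))
    \<comment> \<open>Transporting along \<open>T\<close> replaces the initial density at the moved
      clouds by \<open>q\<close>, so both kernels are now tested against the same density.\<close>
    then show "AE g in \<mu>. (\<integral>g0. K g g0 Os Oe * q g0 \<partial>\<mu>) = (\<integral>g0. K (T g) (T g0) X Y * q g0 \<partial>\<mu>)"
      using AE_space
      by eventually_elim (simp add: marginal_transport[OF T kern[OF XY] dens q P_eq] T_space)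
  qed
  have "AE (g, g0) in \<mu> \<Otimes>\<^sub>M \<mu>. K g g0 Os Oe = K (\<Delta> \<odot> g) (\<Delta> \<odot> g0) (cloud_act \<Delta> Os) Oe"
    using \<Delta> O by (intro transfer haar_left_invariant haar moved) (auto simp: bi_equivariant_def)
  moreover have "AE (g, g0) in \<mu> \<Otimes>\<^sub>M \<mu>.
      K g g0 Os Oe = K (g \<odot> se3_inv \<Delta>) (g0 \<odot> se3_inv \<Delta>) Os (cloud_act \<Delta> Oe)"
    using \<Delta> O by (intro transfer haar_right_invariant haar moved se3_inv_closed) (auto simp: bi_equivariant_def)
  ultimately show "AE (g, g0) in \<mu> \<Otimes>\<^sub>M \<mu>.
      K g g0 Os Oe = K (\<Delta> \<odot> g) (\<Delta> \<odot> g0) (cloud_act \<Delta> Os) Oe \<and>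
      K g g0 Os Oe = K (g \<odot> se3_inv \<Delta>) (g0 \<odot> se3_inv \<Delta>) Os (cloud_act \<Delta> Oe)"
    by eventually_elim auto
qed

theorem proposition2:
  fixes \<mu> :: "rigid measure" and \<O> :: "cloud set" and K :: kernel
  assumes haar: "bi_invariant_haar \<mu>"
    and clouds: "point_cloud_family \<O>"
    and kernel: "diffusion_kernel \<mu> \<O> K"
    and square_integrable: "square_integrable_kernel \<mu> \<O> K"
  shows "((\<forall>X\<in>\<O>. asymmetric_cloud X) \<longrightarrow>
            (preserves_bi_equivariance \<mu> \<O> K \<longleftrightarrow> bi_equivariant_kernel \<mu> \<O> K)) \<and>
         (bi_equivariant_kernel \<mu> \<O> K \<longrightarrow> preserves_bi_equivariance \<mu> \<O> K)"
  using preserves_bi_equivariance_if_kernel[OF haar clouds kernel]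
    kernel_bi_equivariant_if_preserves[OF haar clouds kernel] by blast

end
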